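(* Let $\gamma$ be a real constant, and let $(A_k)_{k}$ and $(B_k)_{k}$ be families of adjacency matrices of finite undirected graphs such that, for each $k$, $A_k$ and $B_k$ are adjacency matrices of graphs on the same set of $n_k$ vertices and commute, i.e. $[A_k,B_k]=A_kB_k-B_kA_k=0$. Suppose that the continuous-time quantum walks on $(A_k)_k$ and on $(B_k)_k$ can both be efficiently implemented (with the same encoding of the vertices of the common vertex set). Then for all $k$ and all $t\ge 0$ $$\exp(-it\gamma(A_k+B_k))=\exp(-it\gamma A_k)\,\exp(-it\gamma B_k),$$ and the continuous-time quantum walk with Hamiltonian $\gamma(A_k+B_k)$ can be efficiently implemented.
   Context: The adjacency matrix $A$ of an undirected graph on vertices $v_1,\dots,v_n$ is the symmetric $n\times n$ matrix with $A_{jk}=1$ if $(v_j,v_k)$ is an edge and $0$ otherwise. The continuous-time quantum walk (CTQW) on a graph with adjacency matrix (or real symmetric matrix) $A$ is the evolution $U(t)=\exp(-itH)$, $t\ge0$, on the Hilbert space $\mathbb{C}^n$ with orthonormal basis indexed by the vertices, where $H=\gamma A$ and $\gamma$ is a fixed real constant (the hopping rate). Efficient implementation: an encoding of $n$ vertices is an injective map from the vertices to the computational basis states of a $q$-qubit register (with $q=m$ if $n=2^m$); it identifies $\mathbb{C}^n$ with a subspace of the register space. A quantum circuit (possibly using additional ancilla qubits that start in and are returned to $|0\rangle$) implements a unitary on $\mathbb{C}^n$ if it acts exactly (error $\epsilon=0$) as that unitary on the encoded subspace. The CTQWs of a family of symmetric matrices $(A_k)_k$ of sizes $n_k$ can be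 efficiently implemented (for given encodings) if there is a polynomial $p$ such that for every $k$ and every $t\ge0$ the operator $\exp(-it\gamma A_k)$ is implemented by a quantum circuit with at most $p(\log n_k)$ one- and two-qubit gates (arbitrary unitary gates, whose parameters may depend on $t$); in particular the bound on the number of gates does not depend on $t$. *)

theory Defs
  imports
    Complex_Main
    "HOL-Computational_Algebra.Polynomial"
    "Graph_Theory.Pair_Digraph"
    "Jordan_Normal_Form.Matrix"
    "Jordan_Normal_Form.Schur_Decomposition"
begin

section \<open>Adjacency matrices of finite undirected graphs\<close>

text \<open>An undirected graph on the vertices \<open>0, \<dots>, n - 1\<close> is a finite pair digraph with a symmetric
  arc relation. Loops are not excluded.\<close>

definition adjacency_mat :: "nat \<Rightarrow> nat pair_pre_digraph \<Rightarrow> real mat" where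
  "adjacency_mat n G = mat n n (\<lambda>(j, k). if (j, k) \<in> parcs G then 1 else 0)"

definition is_adjacency_mat :: "nat \<Rightarrow> real mat \<Rightarrow> bool" where
  "is_adjacency_mat n A \<longleftrightarrow>
     (\<exists>G. pair_pseudo_graph G \<and> pverts G = {..<n} \<and> A = adjacency_mat n G)"


section \<open>Continuous-time quantum walks\<close>

text \<open>The entries of the power series \<open>\<Sum>m. M^m / m!\<close>.\<close>

definition mat_exp :: "complex mat \<Rightarrow> complex mat" where
  "mat_exp M = mat (dim_row M) (dim_row M) (\<lambda>(i, j). \<Sum>m. (M ^\<^sub>m m) $$ (i, j) / fact m)"

lemma mat_exp_entry_summable:
  fixes M :: "complex mat"
  assumes M: "M \<in> carrier_mat n n" and ij: "i < n" "j < n"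
  shows "summable (\<lambda>m. norm ((M ^\<^sub>m m) $$ (i, j) / fact m))"
proof -
  define c where "c = (\<Sum>a<n. \<Sum>b<n. norm (M $$ (a, b)))"
  have c0: "c \<ge> 0" by (simp add: c_def sum_nonneg)
  have c: "(\<Sum>a<n. norm (M $$ (a, b))) \<le> c" if "b < n" for b
  proof -
    have "(\<Sum>a<n. norm (M $$ (a, b))) \<le> (\<Sum>b<n. \<Sum>a<n. norm (M $$ (a, b)))"
      using that by (intro member_le_sum[of b "{..<n}" "\<lambda>b. \<Sum>a<n. norm (M $$ (a, b))"])
        (auto simp: sum_nonneg)
    then show ?thesis unfolding c_def by (subst sum.swap)
  qed
  have bound: "norm ((M ^\<^sub>m m) $$ (i, j)) \<le> c ^ m" if "j < n" for m j
    using that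
  proof (induction m arbitrary: j)
    case 0
    then show ?case using M ij by auto
  next
    case (Suc m)
    have P: "M ^\<^sub>m m \<in> carrier_mat n n" using M by simp
    have "(M ^\<^sub>m Suc m) $$ (i, j) = (\<Sum>a<n. (M ^\<^sub>m m) $$ (i, a) * M $$ (a, j))"
      using P M Suc.prems ij(1) by (simp add: scalar_prod_def lessThan_atLeast0)
    also have "norm \<dots> \<le> (\<Sum>a<n. norm ((M ^\<^sub>m m) $$ (i, a)) * norm (M $$ (a, j)))"
      by (rule order_trans[OF norm_sum]) (simp add: norm_mult)
    also have "\<dots> \<le> (\<Sum>a<n. c ^ m * norm (M $$ (a, j)))"
      by (intro sum_mono mult_right_mono Suc.IH) auto
    also have "\<dots> = c ^ m * (\<Sum>a<n. norm (M $$ (a, j)))" by (simp add: sum_distrib_left)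
    also have "\<dots> \<le> c ^ m * c" using c[OF Suc.prems] c0 by (intro mult_left_mono) auto
    finally show ?case by (simp add: mult.commute)
  qed
  have "summable (\<lambda>m. c ^ m / fact m)"
    using summable_exp[of c] by (simp add: divide_inverse mult.commute)
  then show ?thesis
    by (rule summable_comparison_test') (use bound[OF ij(2)] in \<open>auto simp: norm_divide intro!: divide_right_mono\<close>)
qed

definition ctqw :: "real \<Rightarrow> real mat \<Rightarrow> real \<Rightarrow> complex mat" where
  "ctqw \<gamma> A t = mat_exp ((- \<i> * complex_of_real t) \<cdot>\<^sub>m map_mat complex_of_real (\<gamma> \<cdot>\<^sub>m A))"


section \<open>Quantum circuits\<close>

text \<open>The computational basis states of an \<open>N\<close>-qubit register are the numbers below \<open>2 ^ N\<close>;
  qubit \<open>p\<close> of the basis state \<open>x\<close> is the binary digit of weight \<open>2 ^ p\<close>.\<close>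

definition unitary_mat :: "nat \<Rightarrow> complex mat \<Rightarrow> bool" where
  "unitary_mat d U \<longleftrightarrow> U \<in> carrier_mat d d \<and> mat_adjoint U * U = 1\<^sub>m d"

text \<open>\<open>Gate1 u p\<close> applies the matrix \<open>u\<close> to qubit \<open>p\<close>; \<open>Gate2 u p r\<close> applies \<open>u\<close> to the pair of
  qubits \<open>p, r\<close>, with rows and columns ordered as \<open>00, 01, 10, 11\<close> and \<open>p\<close> the leading digit.\<close>

datatype gate = Gate1 "complex mat" nat | Gate2 "complex mat" nat nat

fun valid_gate :: "nat \<Rightarrow> gate \<Rightarrow> bool" where
  "valid_gate N (Gate1 u p) \<longleftrightarrow> unitary_mat 2 u \<and> p < N"
| "valid_gate N (Gate2 u p r) \<longleftrightarrow> unitary_mat 4 u \<and> p < N \<and> r < N \<and> p \<noteq> r"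

fun gate_mat :: "nat \<Rightarrow> gate \<Rightarrow> complex mat" where
  "gate_mat N (Gate1 u p) = mat (2 ^ N) (2 ^ N) (\<lambda>(x, y).
     if \<forall>s. s \<noteq> p \<longrightarrow> bit x s = bit y s
     then u $$ (of_bool (bit x p), of_bool (bit y p)) else 0)"
| "gate_mat N (Gate2 u p r) = mat (2 ^ N) (2 ^ N) (\<lambda>(x, y).
     if \<forall>s. s \<noteq> p \<and> s \<noteq> r \<longrightarrow> bit x s = bit y s
     then u $$ (2 * of_bool (bit x p) + of_bool (bit x r),
                2 * of_bool (bit y p) + of_bool (bit y r)) else 0)"

text \<open>The head of the list is the gate applied first.\<close>

fun circuit_mat :: "nat \<Rightarrow> gate list \<Rightarrow> complex mat" where
  "circuit_mat N [] = 1\<^sub>m (2 ^ N)"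
| "circuit_mat N (g # gs) = circuit_mat N gs * gate_mat N g"


section \<open>Efficient implementation\<close>

definition vertex_encoding :: "nat \<Rightarrow> nat \<Rightarrow> (nat \<Rightarrow> nat) \<Rightarrow> bool" where
  "vertex_encoding n q e \<longleftrightarrow>
     inj_on e {..<n} \<and> e ` {..<n} \<subseteq> {..<2 ^ q} \<and> (\<forall>m. n = 2 ^ m \<longrightarrow> q = m)"

text \<open>The embedding of the \<open>n\<close>-dimensional vertex space into \<open>N\<close> qubits that maps basis vector \<open>j\<close>
  to the basis state \<open>e j\<close>. If \<open>e j < 2 ^ q\<close> and \<open>q \<le> N\<close>, the qubits from \<open>q\<close> on, which serve as
  ancillas, are all in state \<open>0\<close>.\<close>

definition encoding_mat :: "nat \<Rightarrow> nat \<Rightarrow> (nat \<Rightarrow> nat) \<Rightarrow> complex mat" where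
  "encoding_mat N n e = mat (2 ^ N) n (\<lambda>(x, j). if x = e j then 1 else 0)"

text \<open>A circuit on \<open>q\<close> register qubits and \<open>a\<close> ancillas implements \<open>U\<close> if it sends the encoding of
  every vector \<open>v\<close>, with ancillas in state \<open>0\<close>, to the encoding of \<open>U v\<close>, again with ancillas
  in state \<open>0\<close>.\<close>

definition implements ::
  "nat \<Rightarrow> nat \<Rightarrow> nat \<Rightarrow> (nat \<Rightarrow> nat) \<Rightarrow> gate list \<Rightarrow> complex mat \<Rightarrow> bool" where
  "implements n q a e C U \<longleftrightarrow>
     (\<forall>g \<in> set C. valid_gate (q + a) g) \<and>
     (\<forall>v \<in> carrier_vec n. circuit_mat (q + a) C *\<^sub>v (encoding_mat (q + a) n e *\<^sub>v v)
        = encoding_mat (q + a) n e *\<^sub>v (U *\<^sub>v v))"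

definition efficiently_implementable ::
  "real \<Rightarrow> ('k \<Rightarrow> nat) \<Rightarrow> ('k \<Rightarrow> nat) \<Rightarrow> ('k \<Rightarrow> nat \<Rightarrow> nat) \<Rightarrow> ('k \<Rightarrow> real mat) \<Rightarrow> bool" where
  "efficiently_implementable \<gamma> n q e A \<longleftrightarrow>
     (\<exists>P :: real poly. \<forall>k. \<forall>t \<ge> 0. \<exists>a C.
        implements (n k) (q k) a (e k) C (ctqw \<gamma> (A k) t) \<and>
        real (length C) \<le> poly P (log 2 (real (n k))))"

end

theory Submission
  imports Defs
begin

text \<open>Commuting generators satisfy \<open>exp (X + Y) = exp X * exp Y\<close>, so concatenating the circuits for
  the two walks implements the walk on the sum. The two circuits may use different numbers of
  ancillas; since a gate acts as the identity on every qubit it does not mention, the smaller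
  register can be padded with idle ancillas without changing the circuit.\<close>

section \<open>The exponential of a sum of commuting matrices\<close>

text \<open>Pascal's rule with the matrices abstracted away: \<open>f k l\<close> stands for an
  entry of \<open>X^k Y^l\<close>, and the left side is what multiplying the degree \<open>m\<close>
  expansion by \<open>X + Y\<close> produces.\<close>

lemma sum_choose_Suc:
  fixes f :: "nat \<Rightarrow> nat \<Rightarrow> 'a::comm_semiring_1"
  shows "(\<Sum>k\<le>m. of_nat (m choose k) * (f (Suc k) (m - k) + f k (Suc (m - k))))
    = (\<Sum>k\<le>Suc m. of_nat (Suc m choose k) * f k (Suc m - k))"
proof -
  \<comment> \<open>The sum may run to \<open>Suc m\<close> because \<open>m choose Suc m\<close> is
    0. Splitting off \<open>k = 0\<close> then shifts the index to \<open>Suc k\<close>, where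
    Pascal's rule applies term by term.\<close>
  have "(\<Sum>k\<le>m. of_nat (m choose k) * f k (Suc (m - k)))
      = (\<Sum>k\<le>Suc m. of_nat (m choose k) * f k (Suc m - k))"
    by (simp add: Suc_diff_le binomial_eq_0)
  also have "\<dots> = f 0 (Suc m) + (\<Sum>k\<le>m. of_nat (m choose Suc k) * f (Suc k) (m - k))"
    by (subst sum.atMost_Suc_shift) simp
  finally show ?thesis
    by (subst sum.atMost_Suc_shift) (simp add: algebra_simps sum.distrib)
qed

lemma mat_pow_commute:
  fixes X Y :: "'a::comm_semiring_1 mat"
  assumes X: "X \<in> carrier_mat n n" and Y: "Y \<in> carrier_mat n n" and XY: "X * Y = Y * X"
  shows "Y ^\<^sub>m l * X = X * Y ^\<^sub>m l"
proof (induction l)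
  case 0
  then show ?case using X Y by simp
next
  case (Suc l)
  have P: "Y ^\<^sub>m l \<in> carrier_mat n n" using Y by simp
  have "Y ^\<^sub>m Suc l * X = Y ^\<^sub>m l * (X * Y)"
    using assoc_mult_mat[OF P Y X] XY by simp
  also have "\<dots> = X * Y ^\<^sub>m l * Y"
    using assoc_mult_mat[OF P X Y] Suc by simp
  also have "\<dots> = X * Y ^\<^sub>m Suc l"
    using assoc_mult_mat[OF X P Y] by simp
  finally show ?case .
qed

text \<open>Stated entry by entry to match the entrywise series in \<open>mat_exp\<close>; all sums
  are then sums of scalars.\<close>

lemma mat_binomial:
  fixes X Y :: "'a::comm_semiring_1 mat"
  assumes X: "X \<in> carrier_mat n n" and Y: "Y \<in> carrier_mat n n" and XY: "X * Y = Y * X"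
    and ij: "i < n" "j < n"
  shows "((X + Y) ^\<^sub>m m) $$ (i, j)
    = (\<Sum>k\<le>m. of_nat (m choose k) * (X ^\<^sub>m k * Y ^\<^sub>m (m - k)) $$ (i, j))"
  using ij(2)
\<comment> \<open>The factor \<open>X + Y\<close> is split off on the right, so the induction
  hypothesis is needed for every column \<open>a\<close> of the fixed row \<open>i\<close>.\<close>
proof (induction m arbitrary: j)
  case 0
  then show ?case using X Y ij(1) by simp
next
  case (Suc m)
  define f where "f k l = X ^\<^sub>m k * Y ^\<^sub>m l" for k l
  have f: "f k l \<in> carrier_mat n n" for k l
    unfolding f_def using X Y by (intro mult_carrier_mat[of _ n n]) simp_all
  have P: "X ^\<^sub>m k \<in> carrier_mat n n" "Y ^\<^sub>m k \<in> carrier_mat n n" for k using X Y by simp_all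
  \<comment> \<open>Commutativity enters here: the new factor \<open>X\<close> has to pass
    \<open>Y ^\<^sub>m l\<close> to join the power of \<open>X\<close>.\<close>
  have fX: "f k l * X = f (Suc k) l" for k l
  proof -
    have "f k l * X = X ^\<^sub>m k * (X * Y ^\<^sub>m l)"
      using assoc_mult_mat[OF P(1) P(2) X] mat_pow_commute[OF X Y XY] by (simp add: f_def)
    then show ?thesis using assoc_mult_mat[OF P(1) X P(2)] by (simp add: f_def)
  qed
  have fY: "f k l * Y = f k (Suc l)" for k l
    using assoc_mult_mat[OF P(1) P(2) Y] by (simp add: f_def)
  have "((X + Y) ^\<^sub>m Suc m) $$ (i, j) = (\<Sum>a<n. ((X + Y) ^\<^sub>m m) $$ (i, a) * (X + Y) $$ (a, j))"
    using X Y Suc.prems ij(1) by (simp add: scalar_prod_def lessThan_atLeast0)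
  also have "\<dots> = (\<Sum>a<n. \<Sum>k\<le>m. of_nat (m choose k) * (f k (m - k) $$ (i, a) * (X + Y) $$ (a, j)))"
    by (intro sum.cong refl) (simp add: Suc.IH f_def sum_distrib_right mult.assoc)
  also have "\<dots> = (\<Sum>k\<le>m. of_nat (m choose k) * (\<Sum>a<n. f k (m - k) $$ (i, a) * (X + Y) $$ (a, j)))"
    by (subst sum.swap) (simp add: sum_distrib_left)
  also have "\<dots> = (\<Sum>k\<le>m. of_nat (m choose k) *
      (f (Suc k) (m - k) $$ (i, j) + f k (Suc (m - k)) $$ (i, j)))"
  proof (intro sum.cong refl arg_cong2[where f = "(*)"])
    fix k
    have "(\<Sum>a<n. f k (m - k) $$ (i, a) * (X + Y) $$ (a, j)) = (f k (m - k) * (X + Y)) $$ (i, j)"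
      using X Y f[of k "m - k"] Suc.prems ij(1)
      by (simp add: scalar_prod_def lessThan_atLeast0)
    also have "f k (m - k) * (X + Y) = f (Suc k) (m - k) + f k (Suc (m - k))"
      using mult_add_distrib_mat[OF f X Y] by (simp add: fX fY)
    finally show "(\<Sum>a<n. f k (m - k) $$ (i, a) * (X + Y) $$ (a, j))
        = f (Suc k) (m - k) $$ (i, j) + f k (Suc (m - k)) $$ (i, j)"
      using f[of k "Suc (m - k)"] Suc.prems ij(1) by simp
  qed
  also have "\<dots> = (\<Sum>k\<le>Suc m. of_nat (Suc m choose k) * f k (Suc m - k) $$ (i, j))"
    by (rule sum_choose_Suc)
  finally show ?case by (simp only: f_def)
qed

lemma mat_exp_carrier [simp]: "M \<in> carrier_mat n n \<Longrightarrow> mat_exp M \<in> carrier_mat n n"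
  by (simp add: mat_exp_def)

text \<open>An entry of the product is a finite sum over \<open>a\<close> of products of two
  absolutely convergent series. Mertens-style Cauchy multiplication collects them by total degree,
  and the binomial theorem identifies the part of degree \<open>m\<close>.\<close>

lemma mat_exp_add_commuting:
  fixes X Y :: "complex mat"
  assumes X: "X \<in> carrier_mat n n" and Y: "Y \<in> carrier_mat n n" and XY: "X * Y = Y * X"
  shows "mat_exp (X + Y) = mat_exp X * mat_exp Y"
proof (rule eq_matI)
  fix i j assume "i < dim_row (mat_exp X * mat_exp Y)" "j < dim_col (mat_exp X * mat_exp Y)"
  then have ij: "i < n" "j < n" using X Y by (simp_all add: mat_exp_def)
  define x where "x a m = (X ^\<^sub>m m) $$ (i, a) / fact m" for a m
  define y where "y a m = (Y ^\<^sub>m m) $$ (a, j) / fact m" for a m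
  have x: "summable (\<lambda>m. norm (x a m))" if "a < n" for a
    using mat_exp_entry_summable[OF X ij(1) that] by (simp add: x_def)
  have y: "summable (\<lambda>m. norm (y a m))" if "a < n" for a
    using mat_exp_entry_summable[OF Y that ij(2)] by (simp add: y_def)
  \<comment> \<open>The factorials match through
    \<open>(m choose k) / m! = 1 / (k! (m - k)!)\<close>.\<close>
  have coeff: "(\<Sum>a<n. \<Sum>k\<le>m. x a k * y a (m - k)) = ((X + Y) ^\<^sub>m m) $$ (i, j) / fact m" for m
  proof -
    have "(\<Sum>a<n. \<Sum>k\<le>m. x a k * y a (m - k))
        = (\<Sum>k\<le>m. (\<Sum>a<n. (X ^\<^sub>m k) $$ (i, a) * (Y ^\<^sub>m (m - k)) $$ (a, j)) / (fact k * fact (m - k)))"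
      by (subst sum.swap) (simp add: x_def y_def sum_divide_distrib)
    also have "\<dots> = (\<Sum>k\<le>m. of_nat (m choose k) * (X ^\<^sub>m k * Y ^\<^sub>m (m - k)) $$ (i, j) / fact m)"
    proof (intro sum.cong refl)
      fix k assume "k \<in> {..m}"
      then have "(of_nat (m choose k) :: complex) = fact m / (fact k * fact (m - k))"
        by (simp add: binomial_fact)
      moreover have "(X ^\<^sub>m k * Y ^\<^sub>m (m - k)) $$ (i, j)
          = (\<Sum>a<n. (X ^\<^sub>m k) $$ (i, a) * (Y ^\<^sub>m (m - k)) $$ (a, j))"
        using X Y ij by (simp add: scalar_prod_def lessThan_atLeast0)
      ultimately show "(\<Sum>a<n. (X ^\<^sub>m k) $$ (i, a) * (Y ^\<^sub>m (m - k)) $$ (a, j)) / (fact k * fact (m - k))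
          = of_nat (m choose k) * (X ^\<^sub>m k * Y ^\<^sub>m (m - k)) $$ (i, j) / fact m"
        by simp
    qed
    also have "\<dots> = ((X + Y) ^\<^sub>m m) $$ (i, j) / fact m"
      by (simp add: mat_binomial[OF X Y XY ij] sum_divide_distrib)
    finally show ?thesis .
  qed
  have "(\<lambda>m. \<Sum>a<n. \<Sum>k\<le>m. x a k * y a (m - k)) sums (\<Sum>a<n. (\<Sum>m. x a m) * (\<Sum>m. y a m))"
    by (intro sums_sum Cauchy_product_sums x y) auto
  then have "(\<Sum>m. ((X + Y) ^\<^sub>m m) $$ (i, j) / fact m) = (\<Sum>a<n. (\<Sum>m. x a m) * (\<Sum>m. y a m))"
    unfolding coeff by (rule sums_unique[symmetric])
  then show "mat_exp (X + Y) $$ (i, j) = (mat_exp X * mat_exp Y) $$ (i, j)"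
    using X Y ij by (simp add: mat_exp_def x_def y_def scalar_prod_def lessThan_atLeast0)
qed (use X Y in \<open>simp_all add: mat_exp_def\<close>)

lemma ctqw_carrier [simp]: "A \<in> carrier_mat n n \<Longrightarrow> ctqw \<gamma> A t \<in> carrier_mat n n"
  by (simp add: ctqw_def)

text \<open>The generator \<open>h M\<close> is linear in \<open>M\<close>, and \<open>h\<close>
  carries the commutation of the real matrices over to the complex generators.\<close>

lemma ctqw_add_commuting:
  assumes A: "A \<in> carrier_mat n n" and B: "B \<in> carrier_mat n n" and AB: "A * B = B * A"
  shows "ctqw \<gamma> (A + B) t = ctqw \<gamma> A t * ctqw \<gamma> B t"
proof -
  define h where "h M = (- \<i> * complex_of_real t) \<cdot>\<^sub>m map_mat complex_of_real (\<gamma> \<cdot>\<^sub>m M)" for M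
  have h: "h M \<in> carrier_mat n n" if "M \<in> carrier_mat n n" for M
    using that by (simp add: h_def)
  \<comment> \<open>Once both scalars are pulled out, the product depends on \<open>M\<close> and
    \<open>N\<close> only through \<open>M * N\<close>.\<close>
  have mult: "h M * h N = ((- \<i> * complex_of_real t * \<gamma>)\<^sup>2) \<cdot>\<^sub>m map_mat complex_of_real (M * N)"
    if "M \<in> carrier_mat n n" "N \<in> carrier_mat n n" for M N
    using that
    by (intro eq_matI)
      (simp_all add: h_def scalar_prod_def sum_distrib_left power2_eq_square mult_ac)
  have "h (A + B) = h A + h B"
    using A B by (intro eq_matI) (auto simp: h_def algebra_simps)
  moreover have "h A * h B = h B * h A"
    by (simp add: mult A B AB)
  ultimately show ?thesis
    using mat_exp_add_commuting[OF h[OF A] h[OF B]] by (simp add: ctqw_def h_def)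
qed

section \<open>Circuits\<close>

lemma gate_mat_carrier [simp]: "gate_mat N g \<in> carrier_mat (2 ^ N) (2 ^ N)"
  by (cases g) simp_all

lemma circuit_mat_carrier [simp]: "circuit_mat N C \<in> carrier_mat (2 ^ N) (2 ^ N)"
proof (induction C)
  case (Cons g C)
  then show ?case using gate_mat_carrier[of N g] by (simp add: mult_carrier_mat)
qed simp

lemma encoding_mat_carrier [simp]: "encoding_mat N n e \<in> carrier_mat (2 ^ N) n"
  by (simp add: encoding_mat_def)

lemma circuit_mat_append: "circuit_mat N (C @ D) = circuit_mat N D * circuit_mat N C"
proof (induction C)
  case Nil
  then show ?case by (simp add: right_mult_one_mat[OF circuit_mat_carrier])
next
  case (Cons g C)
  then show ?case
    by (simp add: assoc_mult_mat[OF circuit_mat_carrier circuit_mat_carrier gate_mat_carrier])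
qed

section \<open>Adding idle qubits to the register\<close>

lemma valid_gate_mono: "valid_gate N g \<Longrightarrow> N \<le> N' \<Longrightarrow> valid_gate N' g"
  by (cases g) auto

text \<open>Translates the size bound on a basis state into the vanishing of its qubits from
  \<open>N\<close> on, the form in which the conditions in \<open>gate_mat\<close> can be
  checked.\<close>

lemma nat_less_power_iff_bits: "(x::nat) < 2 ^ N \<longleftrightarrow> (\<forall>s\<ge>N. \<not> bit x s)"
proof
  assume "x < 2 ^ N"
  then have "take_bit N x = x"
    by (rule take_bit_nat_eq_self)
  then show "\<forall>s\<ge>N. \<not> bit x s"
    by (metis bit_take_bit_iff not_less)
next
  assume "\<forall>s\<ge>N. \<not> bit x s"
  then have "bit (take_bit N x) s = bit x s" for s
    by (cases "s < N") (simp_all add: bit_take_bit_iff)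
  then have "take_bit N x = x"
    by (rule bit_eqI)
  then show "x < 2 ^ N"
    by (simp add: take_bit_nat_eq_self_iff)
qed

lemma gate_mat_pad_entry:
  assumes g: "valid_gate N g" and N: "N \<le> N'" and x: "x < 2 ^ N'" and y: "y < 2 ^ N"
  shows "gate_mat N' g $$ (x, y) = (if x < 2 ^ N then gate_mat N g $$ (x, y) else 0)"
proof -
  have y': "y < 2 ^ N'"
    using y N by (meson less_le_trans one_le_numeral power_increasing)
  show ?thesis
  proof (cases "x < 2 ^ N")
    case True
    with x y y' show ?thesis by (cases g) simp_all
  next
    case False
    \<comment> \<open>The gate is valid for \<open>N\<close> qubits, so it does not act on qubit
      \<open>s\<close>. Since \<open>x\<close> and \<open>y\<close> differ there, the entry is the
      default 0 of \<open>gate_mat\<close>.\<close>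
    then obtain s where "s \<ge> N" "bit x s" by (auto simp: nat_less_power_iff_bits)
    moreover from this y have "\<not> bit y s" by (simp add: nat_less_power_iff_bits)
    ultimately show ?thesis
      using False g x y' by (cases g) auto
  qed
qed

text \<open>For \<open>N \<le> N'\<close> this is the isometric inclusion of the small register into
  the large one with the new, most significant qubits in state 0. It is the encoding by the identity
  of a vertex set of size \<open>2 ^ N\<close>.\<close>

abbreviation pad_mat :: "nat \<Rightarrow> nat \<Rightarrow> complex mat" where
  "pad_mat N' N \<equiv> encoding_mat N' (2 ^ N) (\<lambda>x. x)"

lemma mult_pad_mat_entry:
  assumes "M \<in> carrier_mat r (2 ^ N')" "N \<le> N'" "i < r" "j < 2 ^ N"
  shows "(M * pad_mat N' N) $$ (i, j) = M $$ (i, j)"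
proof -
  have j: "j < 2 ^ N'"
    using assms by (meson less_le_trans one_le_numeral power_increasing)
  have "(M * pad_mat N' N) $$ (i, j) = (\<Sum>a<2 ^ N'. M $$ (i, a) * (if a = j then 1 else 0))"
    using assms by (simp add: encoding_mat_def scalar_prod_def lessThan_atLeast0)
  also have "\<dots> = (\<Sum>a<2 ^ N'. if a = j then M $$ (i, a) else 0)"
    by (intro sum.cong) auto
  finally show ?thesis using j by simp
qed

lemma pad_mat_mult_entry:
  assumes "M \<in> carrier_mat (2 ^ N) c" "i < 2 ^ N'" "j < c"
  shows "(pad_mat N' N * M) $$ (i, j) = (if i < 2 ^ N then M $$ (i, j) else 0)"
proof -
  have "(pad_mat N' N * M) $$ (i, j) = (\<Sum>a<2 ^ N. (if i = a then 1 else 0) * M $$ (a, j))"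
    using assms by (simp add: encoding_mat_def scalar_prod_def lessThan_atLeast0)
  also have "\<dots> = (\<Sum>a<2 ^ N. if a = i then M $$ (a, j) else 0)"
    by (intro sum.cong) auto
  finally show ?thesis by simp
qed

text \<open>Multiplying by the inclusion on the right keeps the first \<open>2 ^ N\<close> columns,
  on the left it fills up with zero rows. Comparing entries leaves exactly
  \<open>gate_mat_pad_entry\<close>.\<close>

lemma gate_mat_pad:
  assumes "valid_gate N g" "N \<le> N'"
  shows "gate_mat N' g * pad_mat N' N = pad_mat N' N * gate_mat N g"
proof (rule eq_matI)
  have dims: "dim_row (gate_mat M g) = 2 ^ M" "dim_col (gate_mat M g) = 2 ^ M" for M
    using gate_mat_carrier by (rule carrier_matD)+
  show "dim_row (gate_mat N' g * pad_mat N' N) = dim_row (pad_mat N' N * gate_mat N g)"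
    "dim_col (gate_mat N' g * pad_mat N' N) = dim_col (pad_mat N' N * gate_mat N g)"
    by (simp_all add: dims encoding_mat_def)
  fix i j
  assume "i < dim_row (pad_mat N' N * gate_mat N g)" "j < dim_col (pad_mat N' N * gate_mat N g)"
  then have "i < 2 ^ N'" "j < 2 ^ N" by (simp_all add: dims encoding_mat_def)
  then show "(gate_mat N' g * pad_mat N' N) $$ (i, j) = (pad_mat N' N * gate_mat N g) $$ (i, j)"
    using assms
    by (simp add: mult_pad_mat_entry[OF gate_mat_carrier] pad_mat_mult_entry[OF gate_mat_carrier]
        gate_mat_pad_entry)
qed

text \<open>The inclusion is moved past the gates one at a time.\<close>

lemma circuit_mat_pad:
  assumes "\<forall>g \<in> set C. valid_gate N g" "N \<le> N'"
  shows "circuit_mat N' C * pad_mat N' N = pad_mat N' N * circuit_mat N C"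
  using assms(1)
proof (induction C)
  case Nil
  then show ?case
    by (simp add: left_mult_one_mat[OF encoding_mat_carrier] right_mult_one_mat[OF encoding_mat_carrier])
next
  case (Cons g C)
  have "circuit_mat N' (g # C) * pad_mat N' N = circuit_mat N' C * (pad_mat N' N * gate_mat N g)"
    using Cons.prems assms(2)
    by (simp add: assoc_mult_mat[OF circuit_mat_carrier gate_mat_carrier encoding_mat_carrier]
        gate_mat_pad)
  also have "\<dots> = pad_mat N' N * circuit_mat N C * gate_mat N g"
    using Cons
    by (simp flip: assoc_mult_mat[OF circuit_mat_carrier encoding_mat_carrier gate_mat_carrier])
  also have "\<dots> = pad_mat N' N * circuit_mat N (g # C)"
    by (simp add: assoc_mult_mat[OF encoding_mat_carrier circuit_mat_carrier gate_mat_carrier])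
  finally show ?case .
qed

text \<open>Every 1 of the encoding lies in a row \<open>e j\<close> below \<open>2 ^ N\<close>, so
  the rows filled in by the inclusion are rightly zero.\<close>

lemma encoding_mat_pad:
  assumes "e ` {..<n} \<subseteq> {..<2 ^ N}"
  shows "pad_mat N' N * encoding_mat N n e = encoding_mat N' n e"
proof (rule eq_matI)
  fix i j assume "i < dim_row (encoding_mat N' n e)" "j < dim_col (encoding_mat N' n e)"
  then have ij: "i < 2 ^ N'" "j < n" by (simp_all add: encoding_mat_def)
  with assms have "e j < 2 ^ N" by auto
  with ij show "(pad_mat N' N * encoding_mat N n e) $$ (i, j) = encoding_mat N' n e $$ (i, j)"
    by (simp add: pad_mat_mult_entry[OF encoding_mat_carrier]) (auto simp: encoding_mat_def)
qed (simp_all add: encoding_mat_def)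

section \<open>Implementations\<close>

text \<open>The encoding into the large register factors through the small one. The inclusion
  commutes past the circuit, which then acts on the small register as assumed, and the two factors
  recombine.\<close>

lemma implements_more_ancillas:
  assumes C: "implements n q a e C U" and U: "U \<in> carrier_mat n n"
    and e: "e ` {..<n} \<subseteq> {..<2 ^ q}" and a: "a \<le> a'"
  shows "implements n q a' e C U"
  unfolding implements_def
proof (intro conjI ballI)
  fix g assume "g \<in> set C"
  then show "valid_gate (q + a') g"
    using C a valid_gate_mono[of "q + a" g "q + a'"] by (simp add: implements_def)
next
  fix v :: "complex vec" assume v: "v \<in> carrier_vec n"
  let ?N = "q + a" and ?N' = "q + a'"
  let ?E = "encoding_mat ?N n e" and ?E' = "encoding_mat ?N' n e" and ?P = "pad_mat ?N' ?N"
  have "{..<(2::nat) ^ q} \<subseteq> {..<2 ^ ?N}"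
    by (simp only: lessThan_subset_iff) (intro power_increasing; simp)
  with e have "e ` {..<n} \<subseteq> {..<2 ^ ?N}"
    by (rule subset_trans)
  then have E': "?E' *\<^sub>v w = ?P *\<^sub>v (?E *\<^sub>v w)" if "w \<in> carrier_vec n" for w
    using that by (simp add: encoding_mat_pad
        flip: assoc_mult_mat_vec[OF encoding_mat_carrier encoding_mat_carrier])
  have Ev: "?E *\<^sub>v v \<in> carrier_vec (2 ^ ?N)"
    using v by (rule mult_mat_vec_carrier[OF encoding_mat_carrier])
  have Uv: "U *\<^sub>v v \<in> carrier_vec n"
    using U v by (rule mult_mat_vec_carrier)
  have "circuit_mat ?N' C *\<^sub>v (?E' *\<^sub>v v) = (circuit_mat ?N' C * ?P) *\<^sub>v (?E *\<^sub>v v)"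
    by (simp add: E'[OF v] assoc_mult_mat_vec[OF circuit_mat_carrier encoding_mat_carrier Ev])
  also have "\<dots> = ?P *\<^sub>v (circuit_mat ?N C *\<^sub>v (?E *\<^sub>v v))"
    using C a
    by (simp add: circuit_mat_pad implements_def
        assoc_mult_mat_vec[OF encoding_mat_carrier circuit_mat_carrier Ev])
  also have "\<dots> = ?E' *\<^sub>v (U *\<^sub>v v)"
    using C v by (simp add: implements_def E'[OF Uv])
  finally show "circuit_mat ?N' C *\<^sub>v (?E' *\<^sub>v v) = ?E' *\<^sub>v (U *\<^sub>v v)" .
qed

text \<open>The first circuit returns its ancillas to 0, so its output is again an encoded vector
  and the second circuit can reuse them. \<open>D\<close> comes first in the list because
  \<open>V\<close> acts first in \<open>U * V\<close>.\<close>

lemma implements_append: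
  assumes C: "implements n q a e C U" and D: "implements n q a e D V"
    and U: "U \<in> carrier_mat n n" and V: "V \<in> carrier_mat n n"
  shows "implements n q a e (D @ C) (U * V)"
  unfolding implements_def
proof (intro conjI ballI)
  fix g assume "g \<in> set (D @ C)"
  then show "valid_gate (q + a) g" using C D by (auto simp: implements_def)
next
  fix v :: "complex vec" assume v: "v \<in> carrier_vec n"
  let ?N = "q + a" and ?E = "encoding_mat (q + a) n e"
  have Ev: "?E *\<^sub>v v \<in> carrier_vec (2 ^ ?N)"
    using v by (rule mult_mat_vec_carrier[OF encoding_mat_carrier])
  have Vv: "V *\<^sub>v v \<in> carrier_vec n"
    using V v by (rule mult_mat_vec_carrier)
  have "circuit_mat ?N (D @ C) *\<^sub>v (?E *\<^sub>v v) = circuit_mat ?N C *\<^sub>v (circuit_mat ?N D *\<^sub>v (?E *\<^sub>v v))"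
    by (simp add: circuit_mat_append assoc_mult_mat_vec[OF circuit_mat_carrier circuit_mat_carrier Ev])
  also have "\<dots> = circuit_mat ?N C *\<^sub>v (?E *\<^sub>v (V *\<^sub>v v))"
    using D v by (simp add: implements_def)
  also have "\<dots> = ?E *\<^sub>v (U *\<^sub>v (V *\<^sub>v v))"
    using C Vv by (simp add: implements_def)
  finally show "circuit_mat ?N (D @ C) *\<^sub>v (?E *\<^sub>v v) = ?E *\<^sub>v (U * V *\<^sub>v v)"
    by (simp add: assoc_mult_mat_vec[OF U V v])
qed

lemma efficiently_implementable_add:
  fixes A B :: "'k \<Rightarrow> real mat"
  assumes A: "\<And>k. A k \<in> carrier_mat (n k) (n k)" and B: "\<And>k. B k \<in> carrier_mat (n k) (n k)"
    and AB: "\<And>k. A k * B k = B k * A k"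
    and e: "\<And>k. e k ` {..<n k} \<subseteq> {..<2 ^ q k}"
    and impA: "efficiently_implementable \<gamma> n q e A"
    and impB: "efficiently_implementable \<gamma> n q e B"
  shows "efficiently_implementable \<gamma> n q e (\<lambda>k. A k + B k)"
proof -
  obtain P where P: "\<And>k t. t \<ge> 0 \<Longrightarrow> \<exists>a C. implements (n k) (q k) a (e k) C (ctqw \<gamma> (A k) t) \<and>
      real (length C) \<le> poly P (log 2 (real (n k)))"
    using impA unfolding efficiently_implementable_def by blast
  obtain Q where Q: "\<And>k t. t \<ge> 0 \<Longrightarrow> \<exists>a C. implements (n k) (q k) a (e k) C (ctqw \<gamma> (B k) t) \<and>
      real (length C) \<le> poly Q (log 2 (real (n k)))"
    using impB unfolding efficiently_implementable_def by blast
  show ?thesis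
    unfolding efficiently_implementable_def
  \<comment> \<open>Gate counts add under concatenation. \<open>P\<close> and \<open>Q\<close> were
    fixed before \<open>k\<close> and \<open>t\<close>, so their sum is a uniform bound.\<close>
  proof (intro exI[of _ "P + Q"] allI impI)
    fix k and t :: real assume t: "t \<ge> 0"
    obtain a C where C: "implements (n k) (q k) a (e k) C (ctqw \<gamma> (A k) t)"
      and lC: "real (length C) \<le> poly P (log 2 (real (n k)))"
      using P[OF t] by blast
    obtain b D where D: "implements (n k) (q k) b (e k) D (ctqw \<gamma> (B k) t)"
      and lD: "real (length D) \<le> poly Q (log 2 (real (n k)))"
      using Q[OF t] by blast
    \<comment> \<open>Both circuits are moved to a common register. Padding leaves the gate lists
      unchanged, so the length bounds survive.\<close>
    have "implements (n k) (q k) (max a b) (e k) C (ctqw \<gamma> (A k) t)"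
      by (rule implements_more_ancillas[OF C ctqw_carrier[OF A] e]) simp
    moreover have "implements (n k) (q k) (max a b) (e k) D (ctqw \<gamma> (B k) t)"
      by (rule implements_more_ancillas[OF D ctqw_carrier[OF B] e]) simp
    ultimately have "implements (n k) (q k) (max a b) (e k) (D @ C) (ctqw \<gamma> (A k + B k) t)"
      unfolding ctqw_add_commuting[OF A B AB]
      by (intro implements_append ctqw_carrier A B)
    moreover have "real (length (D @ C)) \<le> poly (P + Q) (log 2 (real (n k)))"
      using lC lD by simp
    ultimately show "\<exists>a C. implements (n k) (q k) a (e k) C (ctqw \<gamma> (A k + B k) t) \<and>
        real (length C) \<le> poly (P + Q) (log 2 (real (n k)))"
      by blast
  qed
qed

section \<open>Specialisation to commuting adjacency matrices\<close>

lemma is_adjacency_mat_carrier: "is_adjacency_mat n A \<Longrightarrow> A \<in> carrier_mat n n"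
  unfolding is_adjacency_mat_def adjacency_mat_def by (elim exE conjE) (simp only: mat_carrier)

lemma mat_diff_eq_zeroD:
  fixes X Y :: "'a::ab_group_add mat"
  assumes X: "X \<in> carrier_mat n m" and Y: "Y \<in> carrier_mat n m" and eq: "X - Y = 0\<^sub>m n m"
  shows "X = Y"
proof (rule eq_matI)
  fix i j assume "i < dim_row Y" "j < dim_col Y"
  then have ij: "i < n" "j < m" using Y by auto
  then have "(X - Y) $$ (i, j) = 0" by (simp add: eq)
  then show "X $$ (i, j) = Y $$ (i, j)" using X Y ij by simp
qed (use X Y in auto)

theorem mainTheorem1:
  fixes \<gamma> :: real
    and n q :: "'k \<Rightarrow> nat"
    and e :: "'k \<Rightarrow> nat \<Rightarrow> nat"
    and A B :: "'k \<Rightarrow> real mat"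
  assumes "\<And>k. is_adjacency_mat (n k) (A k)"
    and "\<And>k. is_adjacency_mat (n k) (B k)"
    and "\<And>k. A k * B k - B k * A k = 0\<^sub>m (n k) (n k)"
    and "\<And>k. vertex_encoding (n k) (q k) (e k)"
    and "efficiently_implementable \<gamma> n q e A"
    and "efficiently_implementable \<gamma> n q e B"
  shows "(\<forall>k. \<forall>t \<ge> 0. ctqw \<gamma> (A k + B k) t = ctqw \<gamma> (A k) t * ctqw \<gamma> (B k) t)
    \<and> efficiently_implementable \<gamma> n q e (\<lambda>k. A k + B k)"
proof -
  have A: "A k \<in> carrier_mat (n k) (n k)" and B: "B k \<in> carrier_mat (n k) (n k)" for k
    using assms(1,2) by (simp_all add: is_adjacency_mat_carrier)
  have AB: "A k * B k = B k * A k" for k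
    by (rule mat_diff_eq_zeroD[OF mult_carrier_mat[OF A B] mult_carrier_mat[OF B A] assms(3)])
  have e: "e k ` {..<n k} \<subseteq> {..<2 ^ q k}" for k
    using assms(4)[of k] by (simp add: vertex_encoding_def)
  show ?thesis
    using ctqw_add_commuting[OF A B AB] efficiently_implementable_add[OF A B AB e assms(5,6)]
    by blast
qed

end
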